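(* Let $\gamma>0$ and $C>0$ satisfy $0<\gamma C<2$. Then for every $s\in\mathbb{R}$ the set $\mathrm{prox}_{\gamma C\ell_r}(s)$ is given by $$\mathrm{prox}_{\gamma C\ell_{r}}(s)=\begin{cases}\{s\},& s>1+\frac{\gamma C}{2},\\ \{s,\ s-\gamma C\},& s=1+\frac{\gamma C}{2},\\ \{s-\gamma C\},& \gamma C\le s<1+\frac{\gamma C}{2},\\ \{0\},& 0<s<\gamma C,\\ \{s\},& s\le 0.\end{cases}$$
   Context: The ramp loss $\ell_r:\mathbb{R}\to\mathbb{R}$ is defined by $\ell_r(t)=1$ for $t\ge 1$, $\ell_r(t)=t$ for $0\le t<1$, and $\ell_r(t)=0$ for $t<0$. For $\gamma,C>0$ and $s\in\mathbb{R}$, the (set-valued) proximal operator of $\ell_r$ is the set of global minimizers $$\mathrm{prox}_{\gamma C\ell_r}(s)=\arg\min_{v\in\mathbb{R}}\ C\ell_r(v)+\frac{1}{2\gamma}(v-s)^2 .$$ *)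

theory Defs
  imports Complex_Main
begin

definition ramp_loss :: "real \<Rightarrow> real" where
  "ramp_loss t = (if t \<ge> 1 then 1 else if 0 \<le> t then t else 0)"

(* The parameter g is the step size: the quadratic term is weighted by 1 / (2 * g), and f is not
   rescaled. The operator is set-valued and may be empty or have several elements. *)
definition prox :: "real \<Rightarrow> (real \<Rightarrow> real) \<Rightarrow> real \<Rightarrow> real set" where
  "prox g f s = {v. is_arg_min (\<lambda>v. f v + 1 / (2 * g) * (v - s)\<^sup>2) (\<lambda>_. True) v}"

end

theory Submission
  imports Defs
begin

text \<open>Multiplying the objective by \<open>2\<gamma>\<close> does not change its minimizers and leaves
  \<open>2a \<ell>\<^sub>r(v) + (v - s)\<^sup>2\<close> with \<open>a = \<gamma>C\<close>. On \<open>[0,1]\<close> this equals \<open>(v - (s - a))\<^sup>2 + 2as - a\<^sup>2\<close>, and on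
  \<open>[1,\<infinity>)\<close> it equals \<open>(v - s)\<^sup>2 + 2a\<close>; the competing values \<open>2as - a\<^sup>2\<close> and \<open>2a\<close> agree exactly at
  \<open>s = 1 + a/2\<close>. The condition \<open>a < 2\<close> places the critical point \<open>s - a = 1 - a/2\<close> at this
  threshold inside \<open>(0,1)\<close>.\<close>

text \<open>The two objectives differ by the factor \<open>2 * g\<close>, which is positive and so
  preserves order. Nonemptiness of \<open>M\<close> guarantees that \<open>m\<close> is attained,
  which excludes points outside \<open>M\<close> as minimizers.\<close>

lemma prox_eqI:
  fixes g c m s :: real and f :: "real \<Rightarrow> real"
  assumes "g > 0" and "M \<noteq> {}"
    and min: "\<And>v. v \<in> M \<Longrightarrow> 2 * (g * c) * f v + (v - s)\<^sup>2 = m"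
    and gt: "\<And>v. v \<notin> M \<Longrightarrow> m < 2 * (g * c) * f v + (v - s)\<^sup>2"
  shows "prox g (\<lambda>v. c * f v) s = M"
proof -
  let ?q = "\<lambda>v. 2 * (g * c) * f v + (v - s)\<^sup>2"
  let ?h = "\<lambda>v. c * f v + 1 / (2 * g) * (v - s)\<^sup>2"
  have "?h v = ?q v / (2 * g)" for v
    using assms(1) by (simp add: field_simps)
  then have h: "?h v < ?h w \<longleftrightarrow> ?q v < ?q w" for v w
    using assms(1) by (simp add: divide_less_cancel)
  have "(\<forall>w. \<not> ?q w < ?q v) \<longleftrightarrow> v \<in> M" for v
  proof
    assume *: "\<forall>w. \<not> ?q w < ?q v"
    obtain u where "u \<in> M"
      using assms(2) by blast
    then show "v \<in> M"
      using * gt[of v] min[of u] by metis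
  next
    assume "v \<in> M"
    then show "\<forall>w. \<not> ?q w < ?q v"
      using min gt by (metis less_irrefl less_asym)
  qed
  then show ?thesis
    unfolding prox_def is_arg_min_def h by simp
qed

lemma ramp_objective:
  fixes a s v :: real
  shows "v \<ge> 1 \<Longrightarrow> 2 * a * ramp_loss v + (v - s)\<^sup>2 = 2 * a + (v - s)\<^sup>2"
    and "0 \<le> v \<Longrightarrow> v < 1 \<Longrightarrow>
      2 * a * ramp_loss v + (v - s)\<^sup>2 = (v - (s - a))\<^sup>2 + (2 * a * s - a\<^sup>2)"
    and "v < 0 \<Longrightarrow> 2 * a * ramp_loss v + (v - s)\<^sup>2 = (v - s)\<^sup>2"
  by (auto simp: ramp_loss_def power2_eq_square algebra_simps)

lemma square_less_square_diff:
  fixes s v :: real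
  assumes "v < 0" and "0 \<le> s"
  shows "s\<^sup>2 < (v - s)\<^sup>2"
  using power_strict_mono[of s "s - v" 2] assms by (simp add: power2_commute)

theorem proposition1:
  fixes \<gamma> C s :: real
  assumes "\<gamma> > 0" and "C > 0" and "0 < \<gamma> * C" and "\<gamma> * C < 2"
  shows "prox \<gamma> (\<lambda>v. C * ramp_loss v) s =
    (if s > 1 + \<gamma> * C / 2 then {s}
     else if s = 1 + \<gamma> * C / 2 then {s, s - \<gamma> * C}
     else if \<gamma> * C \<le> s \<and> s < 1 + \<gamma> * C / 2 then {s - \<gamma> * C}
     else if 0 < s \<and> s < \<gamma> * C then {0}
     else {s})"
proof -
  define a where "a = \<gamma> * C"
  let ?q = "\<lambda>v. 2 * a * ramp_loss v + (v - s)\<^sup>2"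
  have a: "0 < a" "a < 2"
    using assms by (auto simp: a_def)
  \<comment> \<open>Strict inequality off \<open>M\<close> is checked on each branch of the loss
    separately, with the middle branch in completed-square form.\<close>
  have prox: "prox \<gamma> (\<lambda>v. C * ramp_loss v) s = M"
    if "M \<noteq> {}" "\<And>v. v \<in> M \<Longrightarrow> ?q v = m"
      "\<And>v. v \<notin> M \<Longrightarrow> v \<ge> 1 \<Longrightarrow> m < 2 * a + (v - s)\<^sup>2"
      "\<And>v. v \<notin> M \<Longrightarrow> 0 \<le> v \<Longrightarrow> v < 1 \<Longrightarrow> m < (v - (s - a))\<^sup>2 + (2 * a * s - a\<^sup>2)"
      "\<And>v. v \<notin> M \<Longrightarrow> v < 0 \<Longrightarrow> m < (v - s)\<^sup>2"
    for M m
  proof (rule prox_eqI[OF assms(1) that(1), of C ramp_loss s m, folded a_def])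
    fix v assume "v \<notin> M"
    then show "m < ?q v"
      using that(3-5)[of v] ramp_objective[of v a s]
      by (metis not_le)
  qed (rule that(2))
  have sq: "v \<noteq> w \<Longrightarrow> 0 < (v - w)\<^sup>2" for v w :: real
    by simp
  have neg: "2 * a < (v - s)\<^sup>2" if "1 + a / 2 \<le> s" "v < 0" for v
  proof -
    \<comment> \<open>The difference of the two sides is \<open>(1 - a / 2)\<^sup>2\<close>.\<close>
    have "2 * a \<le> (1 + a / 2)\<^sup>2"
      using zero_le_power2[of "1 - a / 2"] by (simp add: power2_eq_square algebra_simps)
    also have "\<dots> \<le> s\<^sup>2"
      using that a by (intro power_mono) auto
    also have "\<dots> < (v - s)\<^sup>2"
      using that a by (intro square_less_square_diff) auto
    finally show ?thesis .
  qed
  consider "s > 1 + a / 2" | "s = 1 + a / 2" | "a \<le> s" "s < 1 + a / 2" | "0 < s" "s < a" | "s \<le> 0"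
    by linarith
  then have "prox \<gamma> (\<lambda>v. C * ramp_loss v) s =
    (if s > 1 + a / 2 then {s}
     else if s = 1 + a / 2 then {s, s - a}
     else if a \<le> s \<and> s < 1 + a / 2 then {s - a}
     else if 0 < s \<and> s < a then {0}
     else {s})"
  proof cases
    case 1
    \<comment> \<open>The minimum of the middle parabola exceeds \<open>2 * a\<close>, the objective
      at \<open>s\<close>.\<close>
    have "2 * a < 2 * a * s - a\<^sup>2"
      using mult_strict_left_mono[of "1 + a / 2" s "2 * a"] a 1
      by (simp add: power2_eq_square algebra_simps)
    then have "prox \<gamma> (\<lambda>v. C * ramp_loss v) s = {s}"
      using a 1 neg by (intro prox[where m = "2 * a"])
        (auto simp: ramp_loss_def intro: add_nonneg_pos less_le_trans)
    then show ?thesis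
      using 1 by simp
  next
    case 2
    then have eq: "2 * a * s - a\<^sup>2 = 2 * a"
      by (simp add: power2_eq_square algebra_simps)
    have "prox \<gamma> (\<lambda>v. C * ramp_loss v) s = {s, s - a}"
    proof (rule prox[where m = "2 * a"])
      fix v assume "v \<in> {s, s - a}"
      \<comment> \<open>Here \<open>s > 1\<close>, while \<open>s - a = 1 - a / 2\<close> lies in
        \<open>(0,1)\<close> because \<open>a < 2\<close>; the two minimizers sit on different
        branches.\<close>
      moreover have "?q s = 2 * a" "?q (s - a) = 2 * a"
        using a 2 eq ramp_objective(1)[of s a s] ramp_objective(2)[of "s - a" a s] by simp_all
      ultimately show "?q v = 2 * a"
        by blast
    next
      fix v assume "v \<notin> {s, s - a}"
      then show "2 * a < 2 * a + (v - s)\<^sup>2" "2 * a < (v - (s - a))\<^sup>2 + (2 * a * s - a\<^sup>2)"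
        using sq[of v s] sq[of v "s - a"] eq by auto
    qed (use neg 2 in auto)
    then show ?thesis
      using 2 by simp
  next
    case 3
    have "2 * a * s - a\<^sup>2 < 2 * a"
      using mult_strict_left_mono[of s "1 + a / 2" "2 * a"] a 3
      by (simp add: power2_eq_square algebra_simps)
    \<comment> \<open>Since \<open>s\<^sup>2 - (2 * a * s - a\<^sup>2) = (s - a)\<^sup>2\<close>,
      the bound \<open>s\<^sup>2 < (v - s)\<^sup>2\<close> suffices.\<close>
    moreover have "2 * a * s - a\<^sup>2 < (v - s)\<^sup>2" if "v < 0" for v
      using square_less_square_diff[of v s] zero_le_power2[of "s - a"] that a 3
      by (simp add: power2_diff algebra_simps)
    moreover have "?q (s - a) = 2 * a * s - a\<^sup>2"
      using ramp_objective(2)[of "s - a" a s] a 3 by simp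
    ultimately have "prox \<gamma> (\<lambda>v. C * ramp_loss v) s = {s - a}"
      using a 3 by (intro prox[where m = "2 * a * s - a\<^sup>2"])
        (auto intro: add_pos_nonneg less_le_trans)
    then show ?thesis
      using 3 by simp
  next
    case 4
    \<comment> \<open>Both \<open>s < a\<close> and \<open>s < 2\<close> hold, the latter from
      \<open>a < 2\<close>.\<close>
    have "s\<^sup>2 < 2 * a"
      using mult_strict_mono[of s a s 2] a 4 by (simp add: power2_eq_square mult.commute)
    moreover have "s\<^sup>2 < (v - (s - a))\<^sup>2 + (2 * a * s - a\<^sup>2)" if "v \<noteq> 0" "0 \<le> v" for v
    proof -
      \<comment> \<open>This product is the middle-branch objective at \<open>v\<close> minus its
        value \<open>s\<^sup>2\<close> at \<open>0\<close>.\<close>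
      have "0 < v * (v + 2 * (a - s))"
        using that 4 by (intro mult_pos_pos) auto
      then show ?thesis
        by (simp add: power2_eq_square algebra_simps)
    qed
    ultimately have "prox \<gamma> (\<lambda>v. C * ramp_loss v) s = {0}"
      using 4 square_less_square_diff by (intro prox[where m = "s\<^sup>2"])
        (auto simp: ramp_loss_def intro: less_le_trans)
    then show ?thesis
      using 4 a by simp
  next
    case 5
    have "0 < (v - (s - a))\<^sup>2 + (2 * a * s - a\<^sup>2)" if "v \<noteq> s" "0 \<le> v" for v
    proof -
      \<comment> \<open>This is the middle branch before completing the square, a sum of a
        nonnegative and a positive term; at \<open>s\<close> the objective is
        \<open>0\<close>.\<close>
      have "0 < 2 * (a * v) + (v - s)\<^sup>2"
        using that a sq by (intro add_nonneg_pos) auto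
      then show ?thesis
        by (simp add: power2_eq_square algebra_simps)
    qed
    then have "prox \<gamma> (\<lambda>v. C * ramp_loss v) s = {s}"
      using 5 a by (intro prox[where m = 0])
        (auto simp: ramp_loss_def intro: add_pos_nonneg)
    then show ?thesis
      using 5 a by simp
  qed
  then show ?thesis
    unfolding a_def .
qed

end
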